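(* Let $p\ge 5$ be a prime and let $A$ be a nonempty symmetric subset of $\mathbb{F}_p$ (that is, $A=-A$) with $|A\setminus\{0\}|\le 2\log_3(p)$. Then $A$ has a unique difference, i.e., there is $x\in\mathbb{F}_p$ such that there is exactly one ordered pair $(a,b)$ with $a,b\in A$ and $x=a-b$.
   Context: $\mathbb{F}_p$ denotes the field with $p$ elements and $\log_3$ the logarithm with base $3$. A subset $B$ of $\mathbb{F}_p$ is called symmetric if $B=-B$, where $-B=\{-b: b\in B\}$. A nonempty subset $A$ of $\mathbb{F}_p$ has a unique difference if there is $x\in\mathbb{F}_p$ such that there is exactly one ordered pair $(a,b)$, $a,b\in A$, with $x=a-b$. *)

theory Defs
  imports Complex_Main "HOL-Number_Theory.Residues"
begin

definition symmetric_subset :: "('a, 'b) ring_scheme \<Rightarrow> 'a set \<Rightarrow> bool" where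
  "symmetric_subset R B \<longleftrightarrow> B \<subseteq> carrier R \<and> B = (\<lambda>b. \<ominus>\<^bsub>R\<^esub> b) ` B"

definition has_unique_difference :: "('a, 'b) ring_scheme \<Rightarrow> 'a set \<Rightarrow> bool" where
  "has_unique_difference R A \<longleftrightarrow>
     (\<exists>x\<in>carrier R. \<exists>!ab. ab \<in> A \<times> A \<and> x = fst ab \<ominus>\<^bsub>R\<^esub> snd ab)"

end

theory Submission
  imports Defs "HOL-Library.FuncSet"
begin

text \<open>
  As \<open>A = -A\<close>, every \<open>2a = a - (-a)\<close> with \<open>a \<in> A\<close> is a difference. If no difference is unique,
  then \<open>2a = b - c\<close> with \<open>(b, c) \<noteq> (a, -a)\<close> for every \<open>a\<close> in a set \<open>H\<close> of representatives of
  \<open>A - {0}\<close> modulo sign. For a multiplier \<open>t\<close> lift \<open>ta\<close>, \<open>tb\<close>, \<open>tc\<close> to integers of absolute value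
  less than \<open>p/2\<close>. The lift of \<open>2a - b + c\<close> is a multiple of \<open>p\<close> of absolute value less than \<open>2p\<close>,
  so it takes only three values. Since \<open>3 ^ |H| < p\<close>, two multipliers give the same values for
  all \<open>a \<in> H\<close>; the difference \<open>u\<close> of the two lifts then satisfies \<open>2 u(a) = u(b) - u(c)\<close> exactly
  in the integers, is odd and is injective modulo \<open>p\<close>. An \<open>a\<close> maximising \<open>|u(a)|\<close> forces
  \<open>u(b) = u(a)\<close> and \<open>u(c) = u(-a)\<close>, a contradiction.
\<close>

text \<open>For odd \<open>p\<close> this is the residue of least absolute value: the shift by
  \<open>p div 2\<close> before and after reduction makes the range symmetric about 0.\<close>

definition balanced_mod :: "int \<Rightarrow> int \<Rightarrow> int" where
  "balanced_mod p x = (x + p div 2) mod p - p div 2"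

lemma balanced_mod_cong: "[balanced_mod p x = x] (mod p)"
  unfolding balanced_mod_def cong_def by (simp add: mod_diff_left_eq)

lemma balanced_mod_eqI: "[x = y] (mod p) \<Longrightarrow> balanced_mod p x = balanced_mod p y"
  unfolding balanced_mod_def cong_def by (metis mod_add_left_eq)

lemma abs_balanced_mod_less:
  assumes "odd p" "p > 0"
  shows "2 * \<bar>balanced_mod p x\<bar> < p"
proof -
  define r where "r = (x + p div 2) mod p"
  define q where "q = p div 2"
  have "0 \<le> r" "r < p"
    using assms by (auto simp: r_def)
  moreover have "p = 2 * q + 1"
    using assms unfolding q_def by presburger
  ultimately have "2 * \<bar>r - q\<bar> < p"
    by (simp add: abs_if)
  then show ?thesis
    unfolding balanced_mod_def r_def q_def .
qed

lemma cong_imp_eq_if_abs_less: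
  fixes x y p :: int
  assumes "[x = y] (mod p)" "\<bar>x - y\<bar> < p"
  shows "x = y"
proof -
  have "p dvd x - y"
    using assms(1) by (simp add: cong_iff_dvd_diff)
  then show ?thesis
    using assms(2) zdvd_imp_le[of p "\<bar>x - y\<bar>"] by (cases "x = y") auto
qed

text \<open>Both sides are congruent and lie strictly within p/2 of 0, so they cannot differ by a
  nonzero multiple of \<open>p\<close>.\<close>

lemma balanced_mod_minus:
  assumes "odd p" "p > 0"
  shows "balanced_mod p (- x) = - balanced_mod p x"
proof (rule cong_imp_eq_if_abs_less)
  have "[- balanced_mod p x = - x] (mod p)"
    using balanced_mod_cong[of p x] by (simp add: cong_minus_minus_iff)
  then show "[balanced_mod p (- x) = - balanced_mod p x] (mod p)"
    using balanced_mod_cong[of p "- x"] cong_sym cong_trans by blast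
  show "\<bar>balanced_mod p (- x) - - balanced_mod p x\<bar> < p"
    using abs_balanced_mod_less[OF assms, of x] abs_balanced_mod_less[OF assms, of "- x"]
    by linarith
qed

lemma common_integer_lift:
  fixes p :: int and H :: "int set" and b c :: "int \<Rightarrow> int"
  assumes p: "odd p" "p > 0" and H: "finite H" "3 ^ card H < p"
    and rel: "\<And>a. a \<in> H \<Longrightarrow> [2 * a = b a - c a] (mod p)"
  obtains s u where "\<not> p dvd s" "\<And>x. [u x = s * x] (mod p)" "\<And>x. u (- x) = - u x"
    "\<And>x y. [x = y] (mod p) \<Longrightarrow> u x = u y"
    "\<And>a. a \<in> H \<Longrightarrow> 2 * u a = u (b a) - u (c a)"
proof -
  \<comment> \<open>\<open>g t a\<close> is the error of the lifted relation. Restricting the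
    quotients \<open>f t\<close> to \<open>H\<close> places them in an extensional function space
    that can be counted.\<close>
  define g where "g t a =
    2 * balanced_mod p (t * a) - balanced_mod p (t * b a) + balanced_mod p (t * c a)" for t a
  define f where "f t = (\<lambda>a\<in>H. g t a div p)" for t
  have p_dvd_g: "p dvd g t a" if "a \<in> H" for t a
  proof -
    have "[g t a = 2 * (t * a) - t * b a + t * c a] (mod p)"
      unfolding g_def by (intro cong_add cong_diff cong_mult cong_refl balanced_mod_cong)
    moreover have "2 * (t * a) - t * b a + t * c a = t * (2 * a - (b a - c a))"
      by (simp add: algebra_simps)
    moreover have "p dvd 2 * a - (b a - c a)"
      using rel[OF that] by (simp add: cong_iff_dvd_diff)
    ultimately show ?thesis
      by (metis cong_dvd_iff dvd_mult)
  qed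
  have "g t a div p \<in> {-1, 0, 1}" if a: "a \<in> H" for t a
  proof -
    obtain k where k: "g t a = p * k"
      using p_dvd_g[OF a] by blast
    \<comment> \<open>The coefficients have total weight 2 + 1 + 1 = 4, and each lift is below p/2
      in absolute value.\<close>
    have "\<bar>g t a\<bar> < 2 * p"
      unfolding g_def
      using abs_balanced_mod_less[OF p, of "t * a"] abs_balanced_mod_less[OF p, of "t * b a"]
        abs_balanced_mod_less[OF p, of "t * c a"] by linarith
    then have "p * \<bar>k\<bar> < p * 2"
      using p k by (simp add: abs_mult)
    then have "\<bar>k\<bar> < 2"
      using p by simp
    then show ?thesis
      using k p by auto
  qed
  then have "f ` {0..<p} \<subseteq> H \<rightarrow>\<^sub>E {-1, 0, 1}"
    unfolding f_def image_subset_iff restrict_PiE_iff by blast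
  then have "card (f ` {0..<p}) \<le> card (H \<rightarrow>\<^sub>E {-1, 0, 1 :: int})"
    using H by (intro card_mono finite_PiE) auto
  also have "\<dots> = 3 ^ card H"
    using H by (simp add: card_PiE numeral_3_eq_3)
  also have "\<dots> < card {0..<p}"
    using H(2) p by (simp add: zless_nat_eq_int_zless)
  finally have "\<not> inj_on f {0..<p}"
    by (rule pigeonhole)
  then obtain t t' where t: "t \<in> {0..<p}" "t' \<in> {0..<p}" "t \<noteq> t'" and f: "f t = f t'"
    by (auto simp: inj_on_def)
  have g: "g t a = g t' a" if "a \<in> H" for a
  proof -
    have "g t a div p = g t' a div p"
      using f that unfolding f_def by (metis restrict_apply')
    then show ?thesis
      using p_dvd_g[OF that] by (metis dvd_div_mult_self)
  qed
  \<comment> \<open>The errors for \<open>t\<close> and \<open>t'\<close> agree on \<open>H\<close>,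
    so they cancel in this difference and the relation becomes exact.\<close>
  define u where "u x = balanced_mod p (t * x) - balanced_mod p (t' * x)" for x
  show thesis
  proof
    have "\<bar>t - t'\<bar> < p"
      using t(1,2) by auto
    then show "\<not> p dvd t - t'"
      using cong_imp_eq_if_abs_less[of t t' p] t(3) by (auto simp: cong_iff_dvd_diff)
    show "[u x = (t - t') * x] (mod p)" for x
      unfolding u_def left_diff_distrib by (intro cong_diff balanced_mod_cong)
    show "u (- x) = - u x" for x
      unfolding u_def using balanced_mod_minus[OF p] by simp
    show "u x = u y" if "[x = y] (mod p)" for x y
      unfolding u_def using that by (metis balanced_mod_eqI cong_scalar_left)
    show "2 * u a = u (b a) - u (c a)" if "a \<in> H" for a
      using g[OF that] unfolding u_def g_def by (simp add: algebra_simps)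
  qed
qed

theorem theorem1p2:
  fixes p :: nat and A :: "int set"
  assumes "prime p" and "p \<ge> 5"
    and "A \<noteq> {}" and "symmetric_subset (residue_ring (int p)) A"
    and "real (card (A - {\<zero>\<^bsub>residue_ring (int p)\<^esub>})) \<le> 2 * log 3 (real p)"
  shows "has_unique_difference (residue_ring (int p)) A"
proof (rule ccontr)
  assume no_unique: "\<not> has_unique_difference (residue_ring (int p)) A"
  let ?R = "residue_ring (int p)"
  interpret residues "int p" ?R
    using assms(2) by unfold_locales auto
  have p: "prime (int p)" "odd (int p)" "int p > 0"
    using assms(1,2) prime_odd_nat[of p] by auto
  have A: "A \<subseteq> {0..<int p}"
    using assms(4) by (auto simp: symmetric_subset_def res_carrier_eq)
  then have fin: "finite A"
    using finite_subset by blast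
  have minus_eq: "x \<ominus>\<^bsub>?R\<^esub> y = (x - y) mod int p" for x y
    by (simp add: a_minus_def res_neg_eq res_add_eq mod_add_right_eq)
  have neg: "int p - a \<in> A" if "a \<in> A" "a \<noteq> 0" for a
  proof -
    have "\<ominus>\<^bsub>?R\<^esub> a \<in> A"
      using assms(4) that(1) by (auto simp: symmetric_subset_def)
    moreover have "a mod int p = a"
      using A that(1) by auto
    then have "(- a) mod int p = int p - a"
      using that(2) by (simp add: zmod_zminus1_eq_if)
    ultimately show ?thesis
      by (simp add: res_neg_eq)
  qed
  have other: "\<exists>b\<in>A. \<exists>c\<in>A. (b, c) \<noteq> (a, a') \<and> [a - a' = b - c] (mod int p)"
    if "a \<in> A" "a' \<in> A" for a a'
  proof (rule ccontr)
    assume "\<not> ?thesis"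
    then have "\<exists>!ab. ab \<in> A \<times> A \<and> (a - a') mod int p = fst ab \<ominus>\<^bsub>?R\<^esub> snd ab"
      using that unfolding minus_eq cong_def by (intro ex1I[of _ "(a, a')"]) force+
    moreover have "(a - a') mod int p \<in> carrier ?R"
      using p(3) by (simp add: res_carrier_eq)
    ultimately show False
      using no_unique unfolding has_unique_difference_def by blast
  qed
  \<comment> \<open>With representatives in 0..p-1 the negative of a nonzero \<open>a\<close> is
    \<open>p - a\<close>; \<open>H\<close> keeps the smaller of the two.\<close>
  define H where "H = {a \<in> A. 0 < a \<and> 2 * a < int p}"
  have H_cases: "a \<in> H \<or> int p - a \<in> H" if "a \<in> A" "a \<noteq> 0" for a
  proof -
    have "2 * a \<noteq> int p"
      using p(2) by (metis dvd_triv_left)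
    then show ?thesis
      using A that neg[OF that] unfolding H_def by force
  qed
  have finH: "finite H"
    using fin unfolding H_def by simp
  \<comment> \<open>Otherwise \<open>A = {0}\<close>, where 0 = 0 - 0 is a unique
    difference.\<close>
  have "H \<noteq> {}"
  proof
    assume "H = {}"
    then have "A = {0}"
      using H_cases assms(3) by blast
    then show False
      using other[of 0 0] by auto
  qed
  have "A - {0} = H \<union> (\<lambda>a. int p - a) ` H"
  proof (intro equalityI subsetI)
    fix x
    assume "x \<in> A - {0}"
    then have "x \<in> H \<or> int p - x \<in> H"
      using H_cases by blast
    then show "x \<in> H \<union> (\<lambda>a. int p - a) ` H"
      by force
  next
    fix x
    assume "x \<in> H \<union> (\<lambda>a. int p - a) ` H"
    then show "x \<in> A - {0}"
      using neg unfolding H_def by auto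
  qed
  moreover have "H \<inter> (\<lambda>a. int p - a) ` H = {}"
    unfolding H_def by auto
  moreover have "card ((\<lambda>a. int p - a) ` H) = card H"
    by (intro card_image) (auto simp: inj_on_def)
  ultimately have "card (A - {0}) = 2 * card H"
    using finH by (simp add: card_Un_disjoint)
  then have "real (card H) \<le> log 3 (real p)"
    using assms(5) by (simp add: res_zero_eq)
  then have "3 powr real (card H) \<le> real p"
    using p(3) by (subst (asm) le_log_iff) auto
  then have "3 ^ card H \<le> p"
    by (simp add: powr_realpow)
  \<comment> \<open>The logarithmic bound is weak, but the pigeonhole needs a strict one: the only
    prime power of 3 that is prime is 3, and \<open>p\<close> is at least 5.\<close>
  moreover have "3 ^ card H \<noteq> p"
  proof
    assume "3 ^ card H = p"
    then have "card H = 1"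
      using assms(1) prime_power_iff[of "3::nat" "card H"] by simp
    then show False
      using \<open>3 ^ card H = p\<close> assms(2) by simp
  qed
  ultimately have "3 ^ card H < p"
    by simp
  then have card_H: "3 ^ card H < int p"
    by (metis of_nat_less_iff of_nat_numeral of_nat_power)
  have "\<forall>a\<in>H. \<exists>b c. b \<in> A \<and> c \<in> A \<and> (b, c) \<noteq> (a, int p - a) \<and>
      [2 * a = b - c] (mod int p)"
  proof
    fix a
    assume "a \<in> H"
    then have "a \<in> A" "a \<noteq> 0"
      unfolding H_def by auto
    then obtain b c where bc: "b \<in> A" "c \<in> A" "(b, c) \<noteq> (a, int p - a)"
      "[a - (int p - a) = b - c] (mod int p)"
      using other[OF _ neg] by blast
    have "[2 * a = a - (int p - a)] (mod int p)"
      by (simp add: cong_iff_dvd_diff)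
    then have "[2 * a = b - c] (mod int p)"
      using bc(4) cong_trans by blast
    then show "\<exists>b c. b \<in> A \<and> c \<in> A \<and> (b, c) \<noteq> (a, int p - a) \<and>
        [2 * a = b - c] (mod int p)"
      using bc(1-3) by blast
  qed
  then obtain b c where "\<forall>a\<in>H. b a \<in> A \<and> c a \<in> A \<and> (b a, c a) \<noteq> (a, int p - a) \<and>
      [2 * a = b a - c a] (mod int p)"
    unfolding bchoice_iff by (elim exE) (rule that)
  then have bc: "b a \<in> A" "c a \<in> A" "(b a, c a) \<noteq> (a, int p - a)"
      "[2 * a = b a - c a] (mod int p)" if "a \<in> H" for a
    using that by blast+
  obtain s u where s: "\<not> int p dvd s" and u: "\<And>x. [u x = s * x] (mod int p)"
      "\<And>x. u (- x) = - u x" "\<And>x y. [x = y] (mod int p) \<Longrightarrow> u x = u y"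
      "\<And>a. a \<in> H \<Longrightarrow> 2 * u a = u (b a) - u (c a)"
    by (rule common_integer_lift[OF p(2,3) finH card_H bc(4)]) (assumption, rule that)
  have u_neg: "u (int p - x) = - u x" for x
    using u(2)[of x] u(3)[of "int p - x" "- x"] by (simp add: cong_iff_dvd_diff)
  \<comment> \<open>\<open>u x\<close> is congruent to \<open>s * x\<close>, and \<open>s\<close> is
    invertible modulo \<open>p\<close>.\<close>
  have u_inj: "x = y" if "x \<in> A" "y \<in> A" "u x = u y" for x y
  proof -
    have "[s * x = s * y] (mod int p)"
      using u(1)[of x] u(1)[of y] that(3) by (metis cong_sym cong_trans)
    moreover have "coprime s (int p)"
      using prime_imp_coprime[OF p(1) s] by (simp add: coprime_commute)
    ultimately have "[x = y] (mod int p)"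
      using cong_mult_lcancel by blast
    moreover have "x \<in> {0..<int p}" "y \<in> {0..<int p}"
      using A that(1,2) by blast+
    then have "\<bar>x - y\<bar> < int p"
      by auto
    ultimately show ?thesis
      by (rule cong_imp_eq_if_abs_less)
  qed
  have "Max ((\<lambda>x. \<bar>u x\<bar>) ` H) \<in> (\<lambda>x. \<bar>u x\<bar>) ` H"
    using finH \<open>H \<noteq> {}\<close> by (intro Max_in) auto
  then obtain a where a: "a \<in> H" and max_eq: "Max ((\<lambda>x. \<bar>u x\<bar>) ` H) = \<bar>u a\<bar>"
    by blast
  have max: "\<bar>u x\<bar> \<le> \<bar>u a\<bar>" if "x \<in> H" for x
    unfolding max_eq[symmetric] using finH that by simp
  \<comment> \<open>The maximum over \<open>H\<close> bounds all of \<open>A\<close>, since passing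
    from \<open>x\<close> to \<open>p - x\<close> only flips the sign of \<open>u\<close>, and
    \<open>u 0 = 0\<close> by oddness.\<close>
  have bound: "\<bar>u x\<bar> \<le> \<bar>u a\<bar>" if "x \<in> A" for x
  proof (cases "x = 0")
    case True
    then show ?thesis
      using u(2)[of 0] by simp
  next
    case False
    then show ?thesis
      using H_cases[OF that] max[of x] max[of "int p - x"] u_neg[of x] by auto
  qed
  \<comment> \<open>Both terms on the right of \<open>2 * u a = u (b a) - u (c a)\<close> are at
    most \<open>\<bar>u a\<bar>\<close> in absolute value, so both must attain it with the right
    signs.\<close>
  have "u (b a) = u a" "u (c a) = u (int p - a)"
    using u(4)[OF a] bound[OF bc(1)[OF a]] bound[OF bc(2)[OF a]] u_neg[of a] by linarith+
  moreover have "a \<in> A" "a \<noteq> 0"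
    using a unfolding H_def by auto
  ultimately have "b a = a" "c a = int p - a"
    using u_inj bc(1,2)[OF a] neg by blast+
  then show False
    using bc(3)[OF a] by simp
qed

end
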